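(* Let $k$ be a positive integer. Every $f \in \mathbb{N}_0[x_1^{\pm 1}, \ldots, x_k^{\pm 1}]$ with $f(1, \ldots, 1) > 3$ and $|\mathrm{supp}(f)| > 1$ can be written as the sum of two multiplicative irreducibles of $\mathbb{N}_0[x_1^{\pm 1}, \ldots, x_k^{\pm 1}]$.
   Context: $\mathbb{N}_0$ is the semiring of nonnegative integers, and $\mathbb{N}_0[x_1^{\pm 1}, \ldots, x_k^{\pm 1}]$ is the semiring of Laurent polynomials in $k$ variables with coefficients in $\mathbb{N}_0$. $\mathrm{supp}(f) \subseteq \mathbb{Z}^k$ is the set of exponent vectors of $f$ with nonzero coefficient, so $|\mathrm{supp}(f)|>1$ means that $f$ is nonzero and not a monomial $c\,x_1^{n_1}\cdots x_k^{n_k}$. A multiplicative irreducible of a semiring $T$ (contained in an integral domain) is a nonzero non-unit $a \in T$ such that $a = bc$ with $b, c \in T$ implies that $b$ or $c$ is a unit of $T$ (i.e., has a multiplicative inverse in $T$). *)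

theory Defs
  imports
    "HOL-Library.Poly_Mapping"
    "HOL-Computational_Algebra.Factorial_Ring"
    "HOL-Analysis.Finite_Cartesian_Product"
begin

text \<open>
  The monoid algebra of the group \<open>int ^ 'k\<close> over \<open>'a\<close>, with the convolution product
  of \<^theory>\<open>HOL-Library.Poly_Mapping\<close>, is the semiring of Laurent polynomials over \<open>'a\<close> in
  the variables indexed by \<open>'k\<close>: an element maps an exponent vector to its coefficient,
  and \<^const>\<open>Poly_Mapping.keys\<close> is the support.
\<close>

type_synonym ('a, 'k) laurent_mpoly = "(int ^ 'k) \<Rightarrow>\<^sub>0 'a"

text \<open>The value at \<open>x\<close> is meaningful only if all coordinates of \<open>x\<close> are nonzero.\<close>

definition laurent_eval :: "(nat, 'k::finite) laurent_mpoly \<Rightarrow> 'b::field ^ 'k \<Rightarrow> 'b" where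
  "laurent_eval f x =
     (\<Sum>n\<in>Poly_Mapping.keys f. of_nat (Poly_Mapping.lookup f n) * (\<Prod>i\<in>UNIV. (x $ i) powi (n $ i)))"

end

theory Submission
  imports Defs "HOL-Computational_Algebra.Primes" "HOL-Library.Discrete_Functions"
begin

text \<open>
  Pick a coordinate on which the support is not constant and cut \<open>f\<close> by the value of this coordinate
  into a part below the middle of its range, a part on the middle and a part above it. Move one term
  \<open>x^s\<close> of minimal level to the upper part and one term \<open>x^t\<close> of maximal level to the lower part, and
  distribute the middle part among the two. A polynomial \<open>x^s + m + u\<close> with \<open>m\<close> on the middle level
  and \<open>u\<close> above it factors properly only if \<open>m(1) = \<beta> + \<gamma>\<close> and \<open>u(1) = \<beta> \<gamma>\<close> for some
  \<open>\<beta>, \<gamma> > 0\<close>. By counting divisors, some distribution of the middle part avoids this on both sides.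
\<close>

section \<open>Terms, coefficient sums and units over the nonnegative integers\<close>

definition xpow :: "'a \<Rightarrow> 'a \<Rightarrow>\<^sub>0 nat" where
  "xpow z = Poly_Mapping.single z 1"

text \<open>The sum of the coefficients, that is, the value of \<open>p\<close> at (1, ...,
  1).\<close>

definition weight :: "('a \<Rightarrow>\<^sub>0 nat) \<Rightarrow> nat" where
  "weight p = (\<Sum>z\<in>Poly_Mapping.keys p. Poly_Mapping.lookup p z)"

lemma keys_xpow [simp]: "Poly_Mapping.keys (xpow z) = {z}"
  by (simp add: xpow_def)

lemma xpow_mult: "xpow y * xpow z = xpow (y + z)"
  by (simp add: xpow_def mult_single)

lemma xpow_dvd_one: "xpow (z :: 'a::ab_group_add) dvd 1"
proof
  show "1 = xpow z * xpow (- z)"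
    by (simp add: xpow_mult) (simp add: xpow_def flip: single_one)
qed

lemma keys_plus_nat:
  "Poly_Mapping.keys (p + q :: 'a \<Rightarrow>\<^sub>0 nat) = Poly_Mapping.keys p \<union> Poly_Mapping.keys q"
  by (auto simp: in_keys_iff lookup_add)

lemma split_key:
  fixes p :: "'a \<Rightarrow>\<^sub>0 nat"
  assumes "z \<in> Poly_Mapping.keys p"
  obtains q where "p = xpow z + q"
proof
  show "p = xpow z + (p - xpow z)"
    using assms
    by (intro poly_mapping_eqI)
      (auto simp: xpow_def lookup_add lookup_minus lookup_single when_def in_keys_iff)
qed

lemma split_keys:
  fixes p :: "'a \<Rightarrow>\<^sub>0 nat"
  obtains q r where "p = q + r" "\<And>z. z \<in> Poly_Mapping.keys q \<longleftrightarrow> z \<in> Poly_Mapping.keys p \<and> P z"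
    "\<And>z. z \<in> Poly_Mapping.keys r \<longleftrightarrow> z \<in> Poly_Mapping.keys p \<and> \<not> P z"
proof
  let ?r = "\<lambda>P. Poly_Mapping.mapp (\<lambda>z n. if P z then n else 0) p"
  show "p = ?r P + ?r (\<lambda>z. \<not> P z)"
    by (intro poly_mapping_eqI) (auto simp: lookup_add lookup_mapp when_def in_keys_iff)
qed (auto simp: in_keys_iff lookup_mapp when_def)

text \<open>Coefficients are nonnegative, so nothing cancels in a product.\<close>

lemma keys_mult_nat:
  fixes p q :: "'a::comm_monoid_add \<Rightarrow>\<^sub>0 nat"
  assumes "y \<in> Poly_Mapping.keys p" "z \<in> Poly_Mapping.keys q"
  shows "y + z \<in> Poly_Mapping.keys (p * q)"
proof -
  obtain p' where p': "p = xpow y + p'" using assms(1) by (rule split_key)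
  obtain q' where q': "q = xpow z + q'" using assms(2) by (rule split_key)
  have "p * q = xpow (y + z) + (xpow y * q' + p' * q)"
    by (simp add: p' q' algebra_simps xpow_mult)
  then show ?thesis by (simp add: keys_plus_nat)
qed

lemma weight_0 [simp]: "weight 0 = 0"
  by (simp add: weight_def)

lemma weight_xpow [simp]: "weight (xpow z) = 1"
  by (simp add: weight_def) (simp add: xpow_def)

lemma weight_plus [simp]: "weight (p + q) = weight p + weight q"
  unfolding weight_def by (rule setsum_keys_plus_distrib) simp_all

lemma weight_eq_0 [simp]: "weight p = 0 \<longleftrightarrow> p = 0"
proof
  show "weight p = 0 \<Longrightarrow> p = 0"
    by (intro poly_mapping_eqI) (auto simp: weight_def in_keys_iff)
qed simp

lemma nonzero_key:
  assumes "p \<noteq> 0"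
  obtains z where "z \<in> Poly_Mapping.keys p"
  using assms by (metis in_keys_iff lookup_zero poly_mapping_eqI)

text \<open>A polynomial with natural coefficients is a sum of terms \<open>xpow z\<close> with
  repetitions; \<open>weight\<close> counts them.\<close>

lemma xpow_induct [case_names zero plus]:
  assumes "P 0" "\<And>z p. P p \<Longrightarrow> P (xpow z + p)"
  shows "P p"
proof (induction "weight p" arbitrary: p)
  case 0
  then show ?case using assms(1) by simp
next
  case (Suc n)
  then have "p \<noteq> 0" by auto
  then obtain z where "z \<in> Poly_Mapping.keys p" by (rule nonzero_key)
  then obtain q where "p = xpow z + q" by (rule split_key)
  with Suc show ?case by (simp add: assms(2))
qed

lemma weight_mult: "weight (p * q) = weight p * weight q"
  for p q :: "'a::comm_monoid_add \<Rightarrow>\<^sub>0 nat"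
proof (induction p rule: xpow_induct)
  case (plus y p)
  have "weight (xpow y * q) = weight q"
    by (induction q rule: xpow_induct) (simp_all add: distrib_left xpow_mult)
  with plus show ?case by (simp add: distrib_right)
qed simp

lemma split_weight:
  assumes "j \<le> weight p"
  obtains q r where "p = q + r" "weight q = j"
  using assms
proof (induction p arbitrary: j thesis rule: xpow_induct)
  case zero
  then show ?case by (metis add_0 le_zero_eq weight_0)
next
  case (plus z p)
  show ?case
  proof (cases j)
    case 0
    then show ?thesis using plus.prems(1)[of 0] by simp
  next
    case (Suc i)
    with plus.prems(2) have "i \<le> weight p" by simp
    then obtain q r where "p = q + r" "weight q = i" using plus.IH by blast
    then show ?thesis using plus.prems(1)[of "xpow z + q" r] Suc by (simp add: add.assoc)
  qed
qed

lemma weight_dvd_one: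
  fixes p :: "'a::comm_monoid_add \<Rightarrow>\<^sub>0 nat"
  assumes "p dvd 1"
  shows "weight p = 1"
proof -
  obtain q where "1 = p * q" using assms by (elim dvdE)
  then have "weight p * weight q = weight (1 :: 'a \<Rightarrow>\<^sub>0 nat)" by (simp flip: weight_mult)
  then show ?thesis by (simp add: weight_def)
qed

text \<open>With \<open>weight_dvd_one\<close>, the units are exactly the polynomials of weight 1,
  because \<open>weight\<close> is multiplicative and a single term has its inverse at the negated
  exponent.\<close>

lemma weight_1_dvd_one:
  fixes p :: "'a::ab_group_add \<Rightarrow>\<^sub>0 nat"
  assumes "weight p = 1"
  shows "p dvd 1"
proof -
  have "p \<noteq> 0" using assms by auto
  then obtain z where "z \<in> Poly_Mapping.keys p" by (rule nonzero_key)
  then obtain q where "p = xpow z + q" by (rule split_key)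
  then show ?thesis using assms by (simp add: xpow_dvd_one)
qed

text \<open>As 2 is prime, one factor has weight 1 and is a unit.\<close>

lemma irreducible_weight_2:
  fixes p :: "'a::ab_group_add \<Rightarrow>\<^sub>0 nat"
  assumes "weight p = 2"
  shows "irreducible p"
proof (rule irreducibleI)
  fix a b assume "p = a * b"
  then have "weight a * weight b = 2" using assms by (simp add: weight_mult)
  then have "weight a = 1 \<or> weight b = 1"
    by (intro prime_product) simp
  then show "a dvd 1 \<or> b dvd 1" by (auto intro: weight_1_dvd_one)
qed (use assms weight_dvd_one[of p] in auto)

section \<open>Sums of complementary divisors\<close>

text \<open>The obstruction to irreducibility: in (x^a + b) (x^c + d) the cross terms have weight
  \<beta> + \<gamma> and b d has weight \<beta> \<gamma>, where \<beta> and \<gamma> are the weights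
  of b and d.\<close>

definition sum_product :: "nat \<Rightarrow> nat \<Rightarrow> bool" where
  "sum_product \<mu> \<pi> \<longleftrightarrow> (\<exists>\<beta> \<gamma>. 0 < \<beta> \<and> 0 < \<gamma> \<and> \<mu> = \<beta> + \<gamma> \<and> \<pi> = \<beta> * \<gamma>)"

lemma sum_product_0 [simp]: "\<not> sum_product 0 \<pi>" "\<not> sum_product \<mu> 0"
  by (auto simp: sum_product_def)

lemma sum_product_square_le:
  assumes "sum_product \<mu> \<pi>"
  shows "4 * \<pi> \<le> \<mu>\<^sup>2"
proof -
  obtain \<beta> \<gamma> where "\<mu> = \<beta> + \<gamma>" "\<pi> = \<beta> * \<gamma>" using assms by (auto simp: sum_product_def)
  moreover have "4 * (int \<beta> * int \<gamma>) \<le> (int \<beta> + int \<gamma>)\<^sup>2"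
    using zero_le_power2[of "int \<beta> - int \<gamma>"] by (simp add: power2_eq_square algebra_simps)
  ultimately show ?thesis by (metis of_nat_add of_nat_le_iff of_nat_mult of_nat_numeral of_nat_power)
qed

text \<open>The smaller factor \<beta> determines the sum \<beta> + \<pi> / \<beta> and is at most
  the square root of \<pi>.\<close>

lemma card_sum_product:
  "finite {\<mu>. sum_product \<mu> \<pi>}" "card {\<mu>. sum_product \<mu> \<pi>} \<le> floor_sqrt \<pi>"
proof -
  have *: "{\<mu>. sum_product \<mu> \<pi>} \<subseteq> (\<lambda>\<beta>. \<beta> + \<pi> div \<beta>) ` {1..floor_sqrt \<pi>}"
  proof
    fix \<mu> assume "\<mu> \<in> {\<mu>. sum_product \<mu> \<pi>}"
    then obtain \<beta> \<gamma> where "0 < \<beta>" "\<beta> \<le> \<gamma>" "\<mu> = \<beta> + \<gamma>" "\<pi> = \<beta> * \<gamma>"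
      unfolding sum_product_def mem_Collect_eq by (metis add.commute mult.commute nat_le_linear)
    moreover from this have "\<beta> \<le> floor_sqrt \<pi>"
      by (intro le_floor_sqrtI) (simp add: power2_eq_square)
    ultimately show "\<mu> \<in> (\<lambda>\<beta>. \<beta> + \<pi> div \<beta>) ` {1..floor_sqrt \<pi>}" by (intro image_eqI[of _ _ \<beta>]) simp_all
  qed
  show "finite {\<mu>. sum_product \<mu> \<pi>}" using * by (rule finite_subset) simp
  have "card {\<mu>. sum_product \<mu> \<pi>} \<le> card {1..floor_sqrt \<pi>}"
    using * by (rule surj_card_le[rotated]) simp
  then show "card {\<mu>. sum_product \<mu> \<pi>} \<le> floor_sqrt \<pi>" by simp
qed

text \<open>
  No \<open>j \<le> floor_sqrt \<pi>\<close> is a sum of two factors of \<open>\<rho> \<ge> \<pi>\<close>, and there are more of them than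
  there are factorizations of \<open>\<pi>\<close>.
\<close>

lemma split_avoiding_sum_product_aux:
  assumes "\<pi> \<le> \<rho>"
  shows "\<exists>j\<le>\<mu>. \<not> sum_product j \<rho> \<and> \<not> sum_product (\<mu> - j) \<pi>"
proof -
  define r where "r = floor_sqrt \<pi>"
  have small: "\<not> sum_product j \<rho>" if "j \<le> r" for j
  proof
    assume j: "sum_product j \<rho>"
    have "j\<^sup>2 \<le> \<rho>" using that assms le_floor_sqrt_iff[of j \<pi>] unfolding r_def by simp
    then have "\<rho> = 0" using sum_product_square_le[OF j] by simp
    with j show False by simp
  qed
  show ?thesis
  proof (cases "r \<le> \<mu>")
    case True
    \<comment> \<open>Pigeonhole: as \<open>r \<le> \<mu>\<close>, these are r + 1 distinct numbers,
      but at most r of them can be sums.\<close>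
    have "\<not> (\<lambda>j. \<mu> - j) ` {0..r} \<subseteq> {\<mu>. sum_product \<mu> \<pi>}"
    proof
      assume "(\<lambda>j. \<mu> - j) ` {0..r} \<subseteq> {\<mu>. sum_product \<mu> \<pi>}"
      then have "card ((\<lambda>j. \<mu> - j) ` {0..r}) \<le> r"
        using card_sum_product unfolding r_def by (meson card_mono order_trans)
      moreover have "inj_on (\<lambda>j. \<mu> - j) {0..r}" using True by (auto simp: inj_on_def)
      ultimately show False by (simp add: card_image)
    qed
    then have "\<exists>j\<in>{0..r}. \<not> sum_product (\<mu> - j) \<pi>"
      by (simp add: image_subset_iff)
    then obtain j where "j \<le> r" "\<not> sum_product (\<mu> - j) \<pi>" by (elim bexE) simp
    then show ?thesis using small True by (intro exI[of _ j]) simp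
  next
    case False
    \<comment> \<open>With \<open>j = \<mu>\<close> the second condition concerns the sum 0, which
      never occurs.\<close>
    then show ?thesis using small[of \<mu>] by (intro exI[of _ \<mu>]) simp
  qed
qed

text \<open>Replacing \<open>j\<close> by \<open>\<mu> - j\<close> exchanges \<pi> and \<rho>, so
  their order does not matter.\<close>

lemma split_avoiding_sum_product:
  obtains j where "j \<le> \<mu>" "\<not> sum_product j \<rho>" "\<not> sum_product (\<mu> - j) \<pi>"
proof (cases "\<pi> \<le> \<rho>")
  case True
  then show ?thesis using split_avoiding_sum_product_aux that by blast
next
  case False
  then obtain j where "j \<le> \<mu>" "\<not> sum_product j \<pi>" "\<not> sum_product (\<mu> - j) \<rho>"
    using split_avoiding_sum_product_aux[of \<rho> \<pi> \<mu>] by auto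
  then show ?thesis using that[of "\<mu> - j"] by simp
qed

section \<open>Irreducibility of x^s plus a middle and an upper part\<close>

lemma decomposition_unique:
  fixes p q :: "'a \<Rightarrow>\<^sub>0 nat"
  assumes "p + q = p' + q'"
    and "\<And>z. z \<in> Poly_Mapping.keys p \<union> Poly_Mapping.keys p' \<Longrightarrow> P z"
    and "\<And>z. z \<in> Poly_Mapping.keys q \<union> Poly_Mapping.keys q' \<Longrightarrow> \<not> P z"
  shows "p = p' \<and> q = q'"
proof -
  have "Poly_Mapping.lookup p z = Poly_Mapping.lookup p' z \<and>
        Poly_Mapping.lookup q z = Poly_Mapping.lookup q' z" for z
  proof -
    have "Poly_Mapping.lookup p z + Poly_Mapping.lookup q z =
          Poly_Mapping.lookup p' z + Poly_Mapping.lookup q' z"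
      using assms(1) by (metis lookup_add)
    moreover have "P z \<Longrightarrow> Poly_Mapping.lookup q z = 0 \<and> Poly_Mapping.lookup q' z = 0"
      "\<not> P z \<Longrightarrow> Poly_Mapping.lookup p z = 0 \<and> Poly_Mapping.lookup p' z = 0"
      using assms(2,3)[of z] by (metis UnI1 UnI2 in_keys_iff)+
    ultimately show ?thesis by (cases "P z") simp_all
  qed
  then show ?thesis by (auto intro: poly_mapping_eqI)
qed

lemma min_key:
  fixes p :: "'a \<Rightarrow>\<^sub>0 nat" and \<phi> :: "'a \<Rightarrow> int"
  assumes "p \<noteq> 0"
  obtains z where "z \<in> Poly_Mapping.keys p" "\<And>y. y \<in> Poly_Mapping.keys p \<Longrightarrow> \<phi> z \<le> \<phi> y"
proof -
  have "Poly_Mapping.keys p \<noteq> {}" using assms nonzero_key by blast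
  then show ?thesis
    using that ex_min_if_finite[of "\<phi> ` Poly_Mapping.keys p"] by (force simp: not_less)
qed

lemma keys_multE:
  assumes "z \<in> Poly_Mapping.keys (p * q)"
  obtains x y where "x \<in> Poly_Mapping.keys p" "y \<in> Poly_Mapping.keys q" "z = x + y"
  using assms keys_mult by blast

text \<open>
  In a product \<open>(x^a + b) (x^c + d)\<close> whose lowest term is \<open>x^(a + c)\<close>, the levels of the keys of
  \<open>x^a d\<close> and \<open>x^c b\<close> add up in pairs to a level of \<open>b d\<close>. If all of them are at least half-way up,
  equality holds throughout, so \<open>b d\<close> lies on the top level and the other two on the middle level.
\<close>

lemma irreducible_xpow_plus:
  fixes \<phi> :: "'a::ab_group_add \<Rightarrow> int" and m t :: "'a \<Rightarrow>\<^sub>0 nat"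
  assumes add: "\<And>y z. \<phi> (y + z) = \<phi> y + \<phi> z"
    and D: "\<phi> s < D"
    and m: "\<And>z. z \<in> Poly_Mapping.keys m \<Longrightarrow> 2 * \<phi> z = \<phi> s + D"
    and t: "\<And>z. z \<in> Poly_Mapping.keys t \<Longrightarrow> \<phi> s + D < 2 * \<phi> z \<and> \<phi> z \<le> D"
    and nonzero: "m + t \<noteq> 0"
    and sp: "\<not> sum_product (weight m) (weight t)"
  shows "irreducible (xpow s + (m + t))"
proof (rule irreducibleI)
  have "weight (m + t) \<noteq> 0" using nonzero by (simp only: weight_eq_0 not_False_eq_True)
  then have w: "weight (xpow s + (m + t)) > 1" by (simp only: weight_plus weight_xpow)
  show "xpow s + (m + t) \<noteq> 0" using w by (metis weight_0 not_less_zero)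
  show "\<not> xpow s + (m + t) dvd 1" using w weight_dvd_one by force
next
  fix a b assume ab: "xpow s + (m + t) = a * b"
  let ?p = "xpow s + (m + t)"
  have q: "\<phi> s + D \<le> 2 * \<phi> z \<and> \<phi> z \<le> D" if "z \<in> Poly_Mapping.keys (m + t)" for z
    using that m[of z] t[of z] D by (auto simp: keys_plus_nat)
  have p: "z = s \<or> \<phi> s < \<phi> z" if "z \<in> Poly_Mapping.keys ?p" for z
    using that q[of z] D by (auto simp: keys_plus_nat[of "xpow s"])
  have "?p \<noteq> 0" by (metis keys_plus_nat keys_xpow keys_zero Un_empty insert_not_empty)
  then have "a \<noteq> 0" "b \<noteq> 0" using ab by auto
  obtain u where u: "u \<in> Poly_Mapping.keys a" "\<And>y. y \<in> Poly_Mapping.keys a \<Longrightarrow> \<phi> u \<le> \<phi> y"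
    using min_key[OF \<open>a \<noteq> 0\<close>, of \<phi>] by blast
  obtain v where v: "v \<in> Poly_Mapping.keys b" "\<And>y. y \<in> Poly_Mapping.keys b \<Longrightarrow> \<phi> v \<le> \<phi> y"
    using min_key[OF \<open>b \<noteq> 0\<close>, of \<phi>] by blast
  have "s \<in> Poly_Mapping.keys (a * b)" by (simp add: keys_plus_nat flip: ab)
  then obtain y z where yz: "y \<in> Poly_Mapping.keys a" "z \<in> Poly_Mapping.keys b" "s = y + z"
    by (rule keys_multE)
  \<comment> \<open>The lowest keys \<open>u\<close> and \<open>v\<close> of the factors add up to a
    key of the product. Its level is at most that of \<open>s\<close>, and \<open>s\<close> is the
    only such key.\<close>
  have "\<phi> (u + v) \<le> \<phi> s" using u(2)[OF yz(1)] v(2)[OF yz(2)] yz(3) by (simp add: add)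
  moreover have "u + v \<in> Poly_Mapping.keys ?p" unfolding ab using u(1) v(1) by (rule keys_mult_nat)
  ultimately have s: "s = u + v" using p by fastforce
  obtain a' where a': "a = xpow u + a'" using u(1) by (rule split_key)
  obtain b' where b': "b = xpow v + b'" using v(1) by (rule split_key)
  have "xpow s + (m + t) = xpow s + ((xpow u * b' + xpow v * a') + a' * b')"
    unfolding ab unfolding a' b' s by (simp add: algebra_simps flip: xpow_mult)
  then have eq: "m + t = (xpow u * b' + xpow v * a') + a' * b'" by (rule add_left_imp_eq)
  show "a dvd 1 \<or> b dvd 1"
  proof (rule ccontr)
    assume nu: "\<not> (a dvd 1 \<or> b dvd 1)"
    then have "a' \<noteq> 0" "b' \<noteq> 0" using xpow_dvd_one[of u] xpow_dvd_one[of v] a' b' by auto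
    have level: "2 * \<phi> (v + y) = \<phi> s + D \<and> 2 * \<phi> (u + z) = \<phi> s + D \<and> \<phi> (y + z) = D"
      if y: "y \<in> Poly_Mapping.keys a'" and z: "z \<in> Poly_Mapping.keys b'" for y z
    proof -
      have "v + y \<in> Poly_Mapping.keys (m + t)" "u + z \<in> Poly_Mapping.keys (m + t)"
           "y + z \<in> Poly_Mapping.keys (m + t)"
        unfolding eq using keys_mult_nat[of v "xpow v" y a'] keys_mult_nat[of u "xpow u" z b']
          keys_mult_nat[OF y z] y z by (auto simp: keys_plus_nat)
      from this[THEN q] show ?thesis by (simp add: add s)
    qed
    obtain y0 where y0: "y0 \<in> Poly_Mapping.keys a'" using \<open>a' \<noteq> 0\<close> by (rule nonzero_key)
    obtain z0 where z0: "z0 \<in> Poly_Mapping.keys b'" using \<open>b' \<noteq> 0\<close> by (rule nonzero_key)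
    have mid: "2 * \<phi> z = \<phi> s + D" if "z \<in> Poly_Mapping.keys (xpow u * b' + xpow v * a')" for z
      using that level[OF y0] level[OF _ z0] by (auto simp: keys_plus_nat elim!: keys_multE)
    have top: "\<phi> z = D" if "z \<in> Poly_Mapping.keys (a' * b')" for z
      using that level by (auto elim!: keys_multE)
    \<comment> \<open>As \<open>\<phi> s < D\<close>, the level \<open>D\<close> is not the middle
      one, so both sides of \<open>eq\<close> can be compared level by level.\<close>
    have "m = xpow u * b' + xpow v * a' \<and> t = a' * b'"
      using eq by (rule decomposition_unique[where P = "\<lambda>z. 2 * \<phi> z = \<phi> s + D"])
        (use mid top m t D in fastforce)+
    then have "weight m = weight a' + weight b'" "weight t = weight a' * weight b'"
      by (simp_all add: weight_mult)
    then show False using sp \<open>a' \<noteq> 0\<close> \<open>b' \<noteq> 0\<close> weight_eq_0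
      unfolding sum_product_def by (metis gr0I)
  qed
qed

section \<open>Distributing the terms between the two summands\<close>

text \<open>With no lower terms besides x^s, the summand containing x^t might be left as the unit
  x^t, so it has to receive a term of \<open>m\<close> or keep one of \<open>u\<close>. Wherever
  \<open>irreducible_xpow_plus\<close> is applied here, its middle or its upper part is 0, which
  rules out \<open>sum_product\<close>.\<close>

lemma sum_irreducibles_no_low:
  fixes \<phi> :: "'a::ab_group_add \<Rightarrow> int" and m u :: "'a \<Rightarrow>\<^sub>0 nat"
  assumes add: "\<And>y z. \<phi> (y + z) = \<phi> y + \<phi> z"
    and D: "\<phi> s < \<phi> t"
    and m: "\<And>z. z \<in> Poly_Mapping.keys m \<Longrightarrow> 2 * \<phi> z = \<phi> s + \<phi> t"
    and u: "\<And>z. z \<in> Poly_Mapping.keys u \<Longrightarrow> \<phi> s + \<phi> t < 2 * \<phi> z \<and> \<phi> z \<le> \<phi> t"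
    and w: "weight m + weight u \<ge> 2"
  shows "\<exists>g h. irreducible g \<and> irreducible h \<and> xpow s + m + (xpow t + u) = g + h"
proof -
  note up = irreducible_xpow_plus[of \<phi> s "\<phi> t", OF add D]
  \<comment> \<open>Negating \<phi> reverses the levels: x^t becomes the lowest term and the middle
    level is preserved.\<close>
  have down: "irreducible (xpow t + (p + 0))" if "p \<noteq> 0"
    "\<And>z. z \<in> Poly_Mapping.keys p \<Longrightarrow> 2 * \<phi> z = \<phi> s + \<phi> t" for p
    by (rule irreducible_xpow_plus[of "\<lambda>z. - \<phi> z" t "- \<phi> s"]) (use that D in \<open>simp_all add: add\<close>)
  consider "weight m = 0" | "0 < weight m" "0 < weight u" | "2 \<le> weight m" "weight u = 0"
    using w by linarith
  then show ?thesis
  proof cases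
    case 1
    then have "1 \<le> weight u" "m = 0" using w by auto
    \<comment> \<open>One term of \<open>u\<close> stays with x^t. It lies on the same side of the
      middle as \<open>t\<close>, so irreducibility comes from weight 2 instead of levels.\<close>
    then obtain u1 u2 where u12: "u = u1 + u2" "weight u1 = 1" using split_weight by metis
    then have "weight u2 > 0" using w 1 by simp
    then have "u2 \<noteq> 0" by auto
    have "irreducible (xpow s + (0 + u2))"
      by (rule up) (use u u12 \<open>u2 \<noteq> 0\<close> in \<open>auto simp: keys_plus_nat\<close>)
    moreover have "irreducible (xpow t + u1)" using u12 by (intro irreducible_weight_2) simp
    ultimately show ?thesis using u12 \<open>m = 0\<close>
      by (intro exI[of _ "xpow s + (0 + u2)"] exI[of _ "xpow t + u1"]) (simp add: ac_simps)
  next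
    case 2
    then have nz: "u \<noteq> 0" "m \<noteq> 0" by auto
    have "irreducible (xpow s + (0 + u))" by (rule up) (use u nz in auto)
    moreover have "irreducible (xpow t + (m + 0))" using m nz by (intro down)
    ultimately show ?thesis
      by (intro exI[of _ "xpow s + (0 + u)"] exI[of _ "xpow t + (m + 0)"]) (simp add: ac_simps)
  next
    case 3
    then have "1 \<le> weight m" "u = 0" by auto
    then obtain m1 m2 where m12: "m = m1 + m2" "weight m1 = 1" using split_weight by metis
    then have "weight m2 > 0" using 3 by simp
    then have nz: "m1 \<noteq> 0" "m2 \<noteq> 0" using m12 by auto
    have "irreducible (xpow s + (m1 + 0))"
      by (rule up) (use m m12 nz in \<open>auto simp: keys_plus_nat\<close>)
    moreover have "irreducible (xpow t + (m2 + 0))"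
      using m m12 nz by (intro down) (auto simp: keys_plus_nat)
    ultimately show ?thesis using m12 \<open>u = 0\<close>
      by (intro exI[of _ "xpow s + (m1 + 0)"] exI[of _ "xpow t + (m2 + 0)"]) (simp add: ac_simps)
  qed
qed

lemma sum_irreducibles:
  fixes \<phi> :: "'a::ab_group_add \<Rightarrow> int" and l m u :: "'a \<Rightarrow>\<^sub>0 nat"
  assumes add: "\<And>y z. \<phi> (y + z) = \<phi> y + \<phi> z"
    and D: "\<phi> s < \<phi> t"
    and l: "\<And>z. z \<in> Poly_Mapping.keys l \<Longrightarrow> 2 * \<phi> z < \<phi> s + \<phi> t \<and> \<phi> s \<le> \<phi> z"
    and m: "\<And>z. z \<in> Poly_Mapping.keys m \<Longrightarrow> 2 * \<phi> z = \<phi> s + \<phi> t"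
    and u: "\<And>z. z \<in> Poly_Mapping.keys u \<Longrightarrow> \<phi> s + \<phi> t < 2 * \<phi> z \<and> \<phi> z \<le> \<phi> t"
    and w: "weight l + weight m + weight u \<ge> 2"
  shows "\<exists>g h. irreducible g \<and> irreducible h \<and> (xpow s + l) + m + (xpow t + u) = g + h"
proof -
  consider "l = 0" | "u = 0" | "l \<noteq> 0" "u \<noteq> 0" by blast
  then show ?thesis
  proof cases
    case 1
    then show ?thesis using sum_irreducibles_no_low[of \<phi> s t m u, OF add D m u] w by simp
  next
    case 2
    \<comment> \<open>The mirror image under negation of \<phi>, with \<open>s\<close> and
      \<open>t\<close> exchanged.\<close>
    have "\<exists>g h. irreducible g \<and> irreducible h \<and> xpow t + m + (xpow s + l) = g + h"
      by (rule sum_irreducibles_no_low[of "\<lambda>z. - \<phi> z"])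
        (use D l m w 2 in \<open>force simp: add\<close>)+
    then show ?thesis using 2 by (simp add: ac_simps)
  next
    case 3
    \<comment> \<open>\<open>j\<close> is the weight of the share of \<open>m\<close> given to x^s,
      which also receives \<open>u\<close>; the rest joins \<open>l\<close> at x^t. As
      \<open>l\<close> and \<open>u\<close> are nonzero, no choice of \<open>j\<close> leaves a lone
      term.\<close>
    obtain j where j: "j \<le> weight m" "\<not> sum_product j (weight u)"
      "\<not> sum_product (weight m - j) (weight l)"
      by (rule split_avoiding_sum_product)
    from j(1) obtain m1 m2 where m12: "m = m1 + m2" "weight m1 = j" by (rule split_weight)
    have nz: "m1 + u \<noteq> 0" "m2 + l \<noteq> 0" using 3
      by (metis add_eq_0_iff_both_eq_0 weight_eq_0 weight_plus)+
    have "irreducible (xpow s + (m1 + u))"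
      by (rule irreducible_xpow_plus[of \<phi> s "\<phi> t", OF add D])
        (use m m12 u j nz in \<open>auto simp: keys_plus_nat\<close>)
    moreover have "irreducible (xpow t + (m2 + l))"
      by (rule irreducible_xpow_plus[of "\<lambda>z. - \<phi> z" t "- \<phi> s"])
        (use m m12 l j nz D in \<open>force simp: keys_plus_nat add\<close>)+
    ultimately show ?thesis using m12
      by (intro exI[of _ "xpow s + (m1 + u)"] exI[of _ "xpow t + (m2 + l)"]) (simp add: ac_simps)
  qed
qed

section \<open>Cutting f along a coordinate\<close>

lemma laurent_eval_one: "laurent_eval f (\<chi> i. 1) = of_nat (weight f)"
  by (simp add: laurent_eval_def weight_def)

theorem corollary3p8:
  fixes f :: "(nat, 'k::finite) laurent_mpoly"
  assumes "laurent_eval f (\<chi> i. (1 :: rat)) > 3"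
    and "card (Poly_Mapping.keys f) > 1"
  shows "\<exists>g h :: (nat, 'k) laurent_mpoly. irreducible g \<and> irreducible h \<and> f = g + h"
proof -
  have w: "weight f > 3" using assms(1) by (simp add: laurent_eval_one)
  obtain y z where yz: "y \<in> Poly_Mapping.keys f" "z \<in> Poly_Mapping.keys f" "y \<noteq> z"
    using assms(2) by (metis One_nat_def card_le_Suc0_iff_eq finite_keys not_less)
  then obtain i where i: "y $ i \<noteq> z $ i" by (auto simp: vec_eq_iff)
  \<comment> \<open>The level function: an additive map that is not constant on the support.\<close>
  define \<phi> :: "int ^ 'k \<Rightarrow> int" where "\<phi> = (\<lambda>x. x $ i)"
  have add: "\<phi> (x + y) = \<phi> x + \<phi> y" for x y by (simp add: \<phi>_def)
  have "f \<noteq> 0" using w by auto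
  obtain s where s: "s \<in> Poly_Mapping.keys f" "\<And>y. y \<in> Poly_Mapping.keys f \<Longrightarrow> \<phi> s \<le> \<phi> y"
    using min_key[OF \<open>f \<noteq> 0\<close>, of \<phi>] by blast
  obtain t where t: "t \<in> Poly_Mapping.keys f" "\<And>y. y \<in> Poly_Mapping.keys f \<Longrightarrow> \<phi> y \<le> \<phi> t"
    using min_key[OF \<open>f \<noteq> 0\<close>, of "\<lambda>z. - \<phi> z"] by auto
  have D: "\<phi> s < \<phi> t"
    using s(2)[OF yz(1)] s(2)[OF yz(2)] t(2)[OF yz(1)] t(2)[OF yz(2)] i by (simp add: \<phi>_def)
  obtain low rest where low: "f = low + rest"
    "\<And>z. z \<in> Poly_Mapping.keys low \<longleftrightarrow> z \<in> Poly_Mapping.keys f \<and> 2 * \<phi> z < \<phi> s + \<phi> t"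
    "\<And>z. z \<in> Poly_Mapping.keys rest \<longleftrightarrow> z \<in> Poly_Mapping.keys f \<and> \<not> 2 * \<phi> z < \<phi> s + \<phi> t"
    using split_keys[of f "\<lambda>z. 2 * \<phi> z < \<phi> s + \<phi> t"] by metis
  obtain m top where top: "rest = m + top"
    "\<And>z. z \<in> Poly_Mapping.keys m \<longleftrightarrow> z \<in> Poly_Mapping.keys rest \<and> 2 * \<phi> z = \<phi> s + \<phi> t"
    "\<And>z. z \<in> Poly_Mapping.keys top \<longleftrightarrow> z \<in> Poly_Mapping.keys rest \<and> 2 * \<phi> z \<noteq> \<phi> s + \<phi> t"
    using split_keys[of rest "\<lambda>z. 2 * \<phi> z = \<phi> s + \<phi> t"] by metis
  have "s \<in> Poly_Mapping.keys low" using s D low by simp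
  then obtain l where l: "low = xpow s + l" by (rule split_key)
  have "t \<in> Poly_Mapping.keys top" using t D low top by simp
  then obtain u where u: "top = xpow t + u" by (rule split_key)
  have f: "f = (xpow s + l) + m + (xpow t + u)" using low(1) top(1) l u by (simp add: add.assoc)
  have "\<exists>g h. irreducible g \<and> irreducible h \<and> (xpow s + l) + m + (xpow t + u) = g + h"
  proof (rule sum_irreducibles[of \<phi>, OF add D])
    show "2 * \<phi> z < \<phi> s + \<phi> t \<and> \<phi> s \<le> \<phi> z" if "z \<in> Poly_Mapping.keys l" for z
      using that low(2)[of z] s(2)[of z] by (simp add: l keys_plus_nat)
    show "2 * \<phi> z = \<phi> s + \<phi> t" if "z \<in> Poly_Mapping.keys m" for z
      using that top(2)[of z] by simp
    show "\<phi> s + \<phi> t < 2 * \<phi> z \<and> \<phi> z \<le> \<phi> t" if "z \<in> Poly_Mapping.keys u" for z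
      using that top(3)[of z] low(3)[of z] t(2)[of z] by (simp add: u keys_plus_nat)
    \<comment> \<open>At least 4 terms counted with multiplicity, minus x^s and x^t.\<close>
    show "2 \<le> weight l + weight m + weight u" using w by (simp add: f)
  qed
  then show ?thesis unfolding f .
qed

end
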